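(* Let $R>0$ and let $\Phi$ be real-analytic on $(-R,R)$ with expansion $\Phi(z)=\sum_{n\ge0}c_nz^n$. Let $u,w$ be analytic with radius of convergence $\Lambda$, and let $0<\lambda<\Lambda$. Set $R_0=\max\{\|u\|_\lambda,\|w\|_\lambda\}$ and assume $R_0<R$. Then $$|\Phi(u)-\Phi(w)|_{\lambda,1}\le\tilde\Phi'(R_0)\,|u-w|_{\lambda,1}+\tilde\Phi''(R_0)\,\bigl(|u|_{\lambda,1}+|w|_{\lambda,1}\bigr)\,\|u-w\|_\lambda .$$
   Context: A function $f:\mathbb{R}^2\to\mathbb{R}$, $f=f(x,v)$, is analytic with radius of convergence $\Lambda>0$ if it is smooth and there is $C>0$ with $\frac{\Lambda^{k+\ell}}{k!\,\ell!}\|\partial_x^k\partial_v^\ell f\|_\infty\le C$ for all $k,\ell\in\mathbb{N}_0$ ($\|\cdot\|_\infty$ is the supremum norm). For functions of $x$ only (resp. $v$ only) take $\ell=0$ (resp. $k=0$). For $\lambda>0$, $n\in\mathbb{N}_0$, $$\|f\|_\lambda=\sum_{k,\ell\ge0}\frac{\lambda^{k+\ell}}{k!\,\ell!}\|\partial_x^k\partial_v^\ell f\|_\infty,\qquad |f|_{\lambda,n}=\frac{d^n}{d\lambda^n}\|f\|_\lambda=\sum_{k+\ell\ge n}\frac{(k+\ell)!}{(k+\ell-n)!}\frac{\lambda^{k+\ell-n}}{k!\,\ell!}\|\partial_x^k\partial_v^\ell f\|_\infty .$$ $\Phi:\mathbb{R}\to\mathbb{R}$ is real-analytic on $(-R,R)$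 if $\Phi(z)=\sum_{n\ge0}c_nz^n$ for all $|z|<R$, with real $c_n$; for $0\le r<R$, $\tilde\Phi'(r)=\sum_{n\ge1}n|c_n|r^{n-1}$ and $\tilde\Phi''(r)=\sum_{n\ge2}n(n-1)|c_n|r^{n-2}$. $\Phi(u)=\sum_{n\ge0}c_nu^n$. *)

theory Defs
  imports "HOL-Analysis.Analysis"
begin

definition partial_x :: "(real \<times> real \<Rightarrow> real) \<Rightarrow> real \<times> real \<Rightarrow> real" where
  "partial_x f = (\<lambda>(x, v). deriv (\<lambda>s. f (s, v)) x)"

definition partial_v :: "(real \<times> real \<Rightarrow> real) \<Rightarrow> real \<times> real \<Rightarrow> real" where
  "partial_v f = (\<lambda>(x, v). deriv (\<lambda>s. f (x, s)) v)"

definition partial_xv :: "nat \<Rightarrow> nat \<Rightarrow> (real \<times> real \<Rightarrow> real) \<Rightarrow> real \<times> real \<Rightarrow> real" where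
  "partial_xv k l f = (partial_x ^^ k) ((partial_v ^^ l) f)"

text \<open>
  For \<open>n > 0\<close> this asks for (Frechet) differentiability of all iterated partial derivatives, in any
  order, up to order \<open>n - 1\<close> and for continuity of those of order \<open>n\<close>.  This is the usual class
  \<open>C\<^sup>n\<close>, because \<open>C\<^sup>1\<close> functions are Frechet differentiable.
\<close>

primrec times_cont_diff :: "nat \<Rightarrow> (real \<times> real \<Rightarrow> real) \<Rightarrow> bool" where
  "times_cont_diff 0 f \<longleftrightarrow> continuous_on UNIV f"
| "times_cont_diff (Suc n) f \<longleftrightarrow>
     f differentiable_on UNIV \<and> times_cont_diff n (partial_x f) \<and> times_cont_diff n (partial_v f)"

definition smooth :: "(real \<times> real \<Rightarrow> real) \<Rightarrow> bool" where
  "smooth f \<longleftrightarrow> (\<forall>n. times_cont_diff n f)"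

text \<open>
  Supremum norms, and the weighted norms built from them, take values in the extended nonnegative
  reals, so that a divergent quantity is \<open>\<infinity>\<close> rather than an arbitrary real number.
\<close>

definition sup_norm :: "(real \<times> real \<Rightarrow> real) \<Rightarrow> ennreal" where
  "sup_norm f = (SUP z. ennreal \<bar>f z\<bar>)"

definition analytic_with_radius :: "real \<Rightarrow> (real \<times> real \<Rightarrow> real) \<Rightarrow> bool" where
  "analytic_with_radius \<Lambda> f \<longleftrightarrow> \<Lambda> > 0 \<and> smooth f \<and>
     (\<exists>C::real. C > 0 \<and>
       (\<forall>k l. ennreal (\<Lambda> ^ (k + l) / (fact k * fact l)) * sup_norm (partial_xv k l f) \<le> ennreal C))"

definition wnorm :: "real \<Rightarrow> (real \<times> real \<Rightarrow> real) \<Rightarrow> ennreal" where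
  "wnorm lam f =
     (\<Sum>\<^sub>\<infinity>(k, l)\<in>UNIV. ennreal (lam ^ (k + l) / (fact k * fact l)) * sup_norm (partial_xv k l f))"

text \<open>The \<open>n\<close>-th derivative of \<open>wnorm lam f\<close> with respect to \<open>lam\<close>, taken term by term.\<close>

definition wnorm_deriv :: "real \<Rightarrow> nat \<Rightarrow> (real \<times> real \<Rightarrow> real) \<Rightarrow> ennreal" where
  "wnorm_deriv lam n f =
     (\<Sum>\<^sub>\<infinity>(k, l)\<in>{(k, l). k + l \<ge> n}.
        ennreal (fact (k + l) / fact (k + l - n) * (lam ^ (k + l - n) / (fact k * fact l)))
          * sup_norm (partial_xv k l f))"

text \<open>
  The series \<open>\<Sum>n\<ge>1. n |c n| r^(n - 1)\<close> and \<open>\<Sum>n\<ge>2. n (n - 1) |c n| r^(n - 2)\<close>; they are finite for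
  \<open>r\<close> below the radius of convergence of \<open>\<Sum>n. c n z^n\<close>.
\<close>

definition majorant_deriv :: "(nat \<Rightarrow> real) \<Rightarrow> ennreal \<Rightarrow> ennreal" where
  "majorant_deriv c r = (\<Sum>\<^sub>\<infinity>n\<in>{1..}. ennreal (real n * \<bar>c n\<bar>) * r ^ (n - 1))"

definition majorant_deriv2 :: "(nat \<Rightarrow> real) \<Rightarrow> ennreal \<Rightarrow> ennreal" where
  "majorant_deriv2 c r = (\<Sum>\<^sub>\<infinity>n\<in>{2..}. ennreal (real (n * (n - 1)) * \<bar>c n\<bar>) * r ^ (n - 2))"

definition real_analytic_expansion :: "(real \<Rightarrow> real) \<Rightarrow> real \<Rightarrow> (nat \<Rightarrow> real) \<Rightarrow> bool" where
  "real_analytic_expansion \<Phi> R c \<longleftrightarrow> (\<forall>z. \<bar>z\<bar> < R \<longrightarrow> (\<lambda>n. c n * z ^ n) sums \<Phi> z)"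

end

theory Submission
  imports Defs
begin

text \<open>
  By the Leibniz rule the coefficients of \<open>\<parallel>f g\<parallel>\<^sub>\<lambda>\<close> are dominated by the Cauchy product of those of
  \<open>\<parallel>f\<parallel>\<^sub>\<lambda>\<close> and \<open>\<parallel>g\<parallel>\<^sub>\<lambda>\<close>, so the norm is submultiplicative and \<open>|f g|\<close> with index \<open>1\<close> obeys the product
  rule.  Applied to \<open>u\<^sup>n\<^sup>+\<^sup>1 - w\<^sup>n\<^sup>+\<^sup>1 = u\<^sup>n (u - w) + (u\<^sup>n - w\<^sup>n) w\<close>, induction on \<open>n\<close> gives the
  estimate for the monomials \<open>z\<^sup>n\<close>.  Summing with weights \<open>|c\<^sub>n|\<close> gives the claim, because
  \<open>R\<^sub>0 < R\<close> makes \<open>\<Sum>n. |c\<^sub>n| \<parallel>u\<^sup>n - w\<^sup>n\<parallel>\<^sub>\<lambda>\<close> finite, so that every partial derivative of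
  \<open>\<Sum>n. c\<^sub>n (u\<^sup>n - w\<^sup>n)\<close> may be taken termwise.
\<close>

section \<open>Infinite sums as integrals over counting measures and as series\<close>

lemma infsum_ennreal_eq_nn_integral:
  fixes f :: "'a \<Rightarrow> ennreal"
  assumes "countable A" "infinite A"
  shows "infsum f A = (\<integral>\<^sup>+x. f x \<partial>count_space A)"
proof -
  \<comment> \<open>Enumerating the infinite set \<open>A\<close> by all naturals turns the
    unordered sum into a series, which is an integral over the counting measure on the naturals; the
    same bijection carries it back to \<open>A\<close>.\<close>
  have bij: "bij_betw (from_nat_into A) UNIV A"
    using assms by (rule bij_betw_from_nat_into)
  have "infsum f A = infsum (\<lambda>n. f (from_nat_into A n)) UNIV"
    by (rule infsum_reindex_bij_betw[OF bij, symmetric])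
  also have "\<dots> = (\<Sum>n. f (from_nat_into A n))"
    by (intro sums_unique has_sum_imp_sums has_sum_infsum nonneg_summable_on_complete) simp
  also have "\<dots> = (\<integral>\<^sup>+n. f (from_nat_into A n) \<partial>count_space UNIV)"
    by (rule nn_integral_count_space_nat[symmetric])
  also have "\<dots> = (\<integral>\<^sup>+x. f x \<partial>count_space A)"
    by (rule nn_integral_bij_count_space[OF bij])
  finally show ?thesis .
qed

definition coef :: "real \<Rightarrow> (real \<times> real \<Rightarrow> real) \<Rightarrow> nat \<times> nat \<Rightarrow> ennreal" where
  "coef lam f = (\<lambda>(k, l). ennreal (lam ^ (k + l) / (fact k * fact l)) * sup_norm (partial_xv k l f))"

text \<open>Weighting each coefficient by its total degree is the effect of the operator lam *
  d/dlam on the norm. Unlike d/dlam itself it involves no truncated exponent.\<close>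

definition degree_sum :: "(nat \<times> nat \<Rightarrow> ennreal) \<Rightarrow> ennreal" where
  "degree_sum a = (\<integral>\<^sup>+p. of_nat (fst p + snd p) * a p \<partial>count_space UNIV)"

text \<open>As an integral the norm comes with additivity, Tonelli and interchange with series, all
  valid for infinite values too.\<close>

lemma wnorm_eq: "wnorm lam f = (\<integral>\<^sup>+p. coef lam f p \<partial>count_space UNIV)"
proof -
  have "infinite (UNIV :: (nat \<times> nat) set)"
    using finite_prod by auto
  then show ?thesis
    unfolding wnorm_def coef_def by (subst infsum_ennreal_eq_nn_integral) auto
qed

text \<open>The quotient of factorials is the degree \<open>k + l\<close>, and the lost power of
  \<open>lam\<close> becomes the factor \<open>1 / lam\<close>. The pair (0, 0), missing from the
  index set on the left, has degree 0 and contributes nothing on the right.\<close>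

lemma wnorm_deriv_1_eq:
  assumes "lam > 0"
  shows "wnorm_deriv lam 1 f = ennreal (1 / lam) * degree_sum (coef lam f)"
proof -
  have inf: "infinite (UNIV :: (nat \<times> nat) set)"
    using finite_prod by auto
  have *: "(case p of (k, l) \<Rightarrow> ennreal (fact (k + l) / fact (k + l - 1) * (lam ^ (k + l - 1) / (fact k * fact l)))
          * sup_norm (partial_xv k l f)) = ennreal (1 / lam) * (of_nat (fst p + snd p) * coef lam f p)"
    if pos: "p \<in> {(k, l). k + l \<ge> 1}" for p
  proof -
    obtain k l where p: "p = (k, l)" by fastforce
    obtain m where m: "k + l = Suc m"
      using pos p by (cases "k + l") auto
    have "fact (k + l) / fact (k + l - 1) * (lam ^ (k + l - 1) / (fact k * fact l))
      = 1 / lam * (real (k + l) * (lam ^ (k + l) / (fact k * fact l)))"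
      using assms by (simp add: m)
    moreover have "ennreal (1 / lam * (real (k + l) * (lam ^ (k + l) / (fact k * fact l))))
      = ennreal (1 / lam) * (of_nat (k + l) * ennreal (lam ^ (k + l) / (fact k * fact l)))"
      using assms by (simp add: ennreal_of_nat_eq_real_of_nat flip: ennreal_mult ennreal_plus)
    ultimately show ?thesis
      by (simp add: p coef_def mult.assoc)
  qed
  have "wnorm_deriv lam 1 f = (\<Sum>\<^sub>\<infinity>p. ennreal (1 / lam) * (of_nat (fst p + snd p) * coef lam f p))"
    unfolding wnorm_deriv_def by (rule infsum_cong_neutral) (use * in auto)
  also have "\<dots> = ennreal (1 / lam) * degree_sum (coef lam f)"
    unfolding degree_sum_def using inf
    by (subst infsum_ennreal_eq_nn_integral) (auto simp: nn_integral_cmult)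
  finally show ?thesis .
qed

text \<open>Used to let both majorants run over all naturals: the factors n and n (n - 1) vanish at
  the added indices, where the exponents are truncated.\<close>

lemma infsum_nat_eq_suminf:
  fixes f :: "nat \<Rightarrow> ennreal"
  assumes "\<And>n. n \<notin> A \<Longrightarrow> f n = 0"
  shows "infsum f A = (\<Sum>n. f n)"
proof -
  have "infsum f A = infsum f UNIV"
    by (rule infsum_cong_neutral) (use assms in auto)
  also have "\<dots> = (\<Sum>n. f n)"
    by (intro sums_unique has_sum_imp_sums has_sum_infsum nonneg_summable_on_complete) simp
  finally show ?thesis .
qed

lemma majorant_deriv_eq: "majorant_deriv c r = (\<Sum>n. ennreal (real n * \<bar>c n\<bar>) * r ^ (n - 1))"
  unfolding majorant_deriv_def by (rule infsum_nat_eq_suminf) (auto simp: not_le)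

lemma majorant_deriv2_eq:
  "majorant_deriv2 c r = (\<Sum>n. ennreal (real (n * (n - 1)) * \<bar>c n\<bar>) * r ^ (n - 2))"
proof -
  have "n * (n - 1) = 0" if "n \<notin> {2..}" for n :: nat
    using that by (cases n) auto
  then show ?thesis
    unfolding majorant_deriv2_def by (intro infsum_nat_eq_suminf) simp
qed

section \<open>Cauchy products of doubly indexed families\<close>

definition cauchy_prod :: "(nat \<times> nat \<Rightarrow> ennreal) \<Rightarrow> (nat \<times> nat \<Rightarrow> ennreal) \<Rightarrow> nat \<times> nat \<Rightarrow> ennreal" where
  "cauchy_prod a b = (\<lambda>(k, l). \<Sum>i\<le>k. \<Sum>j\<le>l. a (i, j) * b (k - i, l - j))"

text \<open>Tonelli after the substitution r = p + q. The general kernel \<open>h\<close> serves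
  both the plain sum of a Cauchy product and its degree-weighted sum.\<close>

lemma nn_integral_convolution:
  fixes h :: "nat \<times> nat \<Rightarrow> nat \<times> nat \<Rightarrow> ennreal"
  shows "(\<integral>\<^sup>+p. (\<Sum>i\<le>fst p. \<Sum>j\<le>snd p. h (i, j) (fst p - i, snd p - j)) \<partial>count_space UNIV)
    = (\<integral>\<^sup>+p. \<integral>\<^sup>+q. h p q \<partial>count_space UNIV \<partial>count_space UNIV)"
proof -
  let ?C = "count_space UNIV :: (nat \<times> nat) measure"
  let ?up = "\<lambda>p :: nat \<times> nat. {r :: nat \<times> nat. fst p \<le> fst r \<and> snd p \<le> snd r}"
  let ?d = "\<lambda>r p :: nat \<times> nat. (fst r - fst p, snd r - snd p)"
  have 1: "(\<Sum>i\<le>fst r. \<Sum>j\<le>snd r. h (i, j) (fst r - i, snd r - j))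
    = (\<integral>\<^sup>+p. h p (?d r p) * indicator (?up p) r \<partial>?C)" for r
  proof -
    have "(\<integral>\<^sup>+p. h p (?d r p) * indicator (?up p) r \<partial>?C)
      = (\<Sum>p\<in>{..fst r} \<times> {..snd r}. h p (?d r p) * indicator (?up p) r)"
      by (rule nn_integral_count_space') (auto simp: indicator_def)
    also have "\<dots> = (\<Sum>p\<in>{..fst r} \<times> {..snd r}. h p (?d r p))"
      by (rule sum.cong) auto
    finally show ?thesis
      by (simp add: sum.cartesian_product split_def)
  qed
  have 2: "(\<integral>\<^sup>+r. h p (?d r p) * indicator (?up p) r \<partial>?C) = (\<integral>\<^sup>+q. h p q \<partial>?C)" for p
  proof -
    \<comment> \<open>For fixed \<open>p\<close>, translation by \<open>p\<close> maps all pairs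
      bijectively onto the pairs above \<open>p\<close>, where the truncated differences in
      \<open>?d\<close> are true differences.\<close>
    have "bij_betw (\<lambda>q. (fst p + fst q, snd p + snd q)) UNIV (?up p)"
      by (rule bij_betwI[where g = "\<lambda>r. ?d r p"]) auto
    from nn_integral_bij_count_space[OF this, of "\<lambda>r. h p (?d r p)"]
    show ?thesis by (simp add: nn_integral_count_space_indicator)
  qed
  have "(\<integral>\<^sup>+r. \<integral>\<^sup>+p. h p (?d r p) * indicator (?up p) r \<partial>?C \<partial>?C)
    = (\<integral>\<^sup>+p. \<integral>\<^sup>+r. h p (?d r p) * indicator (?up p) r \<partial>?C \<partial>?C)"
    using nn_integral_fst_count_space[of "\<lambda>(r, p). h p (?d r p) * indicator (?up p) r"]
      nn_integral_snd_count_space[of "\<lambda>(r, p). h p (?d r p) * indicator (?up p) r"]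
    by simp
  then show ?thesis
    by (simp add: 1 2)
qed

lemma nn_integral_cauchy_prod:
  "(\<integral>\<^sup>+p. cauchy_prod a b p \<partial>count_space UNIV)
    = (\<integral>\<^sup>+p. a p \<partial>count_space UNIV) * (\<integral>\<^sup>+p. b p \<partial>count_space UNIV)"
  using nn_integral_convolution[of "\<lambda>p q. a p * b q"]
  by (simp add: cauchy_prod_def split_def nn_integral_cmult nn_integral_multc)

text \<open>Total degree is additive under r = p + q, so weighting by it acts as a derivation. This
  is the source of the product rule for the norm with index 1.\<close>

lemma degree_sum_cauchy_prod:
  "degree_sum (cauchy_prod a b)
    = degree_sum a * (\<integral>\<^sup>+p. b p \<partial>count_space UNIV) + (\<integral>\<^sup>+p. a p \<partial>count_space UNIV) * degree_sum b"
proof -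
  let ?g = "\<lambda>p :: nat \<times> nat. of_nat (fst p + snd p) :: ennreal"
  have "?g r * cauchy_prod a b r = (\<Sum>i\<le>fst r. \<Sum>j\<le>snd r.
      ?g (i, j) * a (i, j) * b (fst r - i, snd r - j)
      + a (i, j) * (?g (fst r - i, snd r - j) * b (fst r - i, snd r - j)))" for r
  proof -
    have "?g r * (a (i, j) * b (fst r - i, snd r - j)) =
      ?g (i, j) * a (i, j) * b (fst r - i, snd r - j)
      + a (i, j) * (?g (fst r - i, snd r - j) * b (fst r - i, snd r - j))"
      if "i \<le> fst r" "j \<le> snd r" for i j
    proof -
      have "fst r + snd r = (i + j) + (fst r - i + (snd r - j))"
        using that by simp
      then have "?g r = ?g (i, j) + ?g (fst r - i, snd r - j)"
        by (metis fst_conv of_nat_add snd_conv)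
      then show ?thesis by (simp only: distrib_right) (simp add: mult_ac)
    qed
    then show ?thesis
      by (simp add: cauchy_prod_def split_def sum_distrib_left)
  qed
  then have "degree_sum (cauchy_prod a b)
    = (\<integral>\<^sup>+p. \<integral>\<^sup>+q. ?g p * a p * b q + a p * (?g q * b q) \<partial>count_space UNIV \<partial>count_space UNIV)"
    unfolding degree_sum_def
    using nn_integral_convolution[of "\<lambda>p q. ?g p * a p * b q + a p * (?g q * b q)"]
    by simp
  also have "\<dots> = degree_sum a * (\<integral>\<^sup>+p. b p \<partial>count_space UNIV) + (\<integral>\<^sup>+p. a p \<partial>count_space UNIV) * degree_sum b"
    by (simp add: degree_sum_def nn_integral_add nn_integral_cmult nn_integral_multc)
  finally show ?thesis .
qed

section \<open>Iterated partial derivatives and the Leibniz rule\<close>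

text \<open>
  The derivatives of \<open>f\<close> that occur in \<^const>\<open>partial_xv\<close>: first only in \<open>v\<close>, then only in \<open>x\<close>.
  Unlike smoothness this involves no other order of differentiation, so it suffices to exhibit a
  doubly indexed family of functions linked by ordinary one-variable derivatives.
\<close>

definition pure_partials :: "(real \<times> real \<Rightarrow> real) \<Rightarrow> bool" where
  "pure_partials f \<longleftrightarrow>
    (\<forall>k l x v. (\<lambda>s. partial_xv k l f (s, v)) differentiable (at x)) \<and>
    (\<forall>l x v. (\<lambda>s. partial_xv 0 l f (x, s)) differentiable (at v))"

lemma partial_xv_0_0 [simp]: "partial_xv 0 0 f = f"
  by (simp add: partial_xv_def)

lemma partial_xv_Suc_x: "partial_xv (Suc k) l f = partial_x (partial_xv k l f)"
  by (simp add: partial_xv_def)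

lemma partial_xv_Suc_v: "partial_xv 0 (Suc l) f = partial_v (partial_xv 0 l f)"
  by (simp add: partial_xv_def)

lemma pure_partials_DERIV_x:
  assumes "pure_partials f"
  shows "((\<lambda>s. partial_xv k l f (s, v)) has_real_derivative partial_xv (Suc k) l f (x, v)) (at x)"
  using assms unfolding pure_partials_def partial_xv_Suc_x partial_x_def
  by (simp add: DERIV_deriv_iff_real_differentiable)

lemma pure_partials_DERIV_v:
  assumes "pure_partials f"
  shows "((\<lambda>s. partial_xv 0 l f (x, s)) has_real_derivative partial_xv 0 (Suc l) f (x, v)) (at v)"
  using assms unfolding pure_partials_def partial_xv_Suc_v partial_v_def
  by (simp add: DERIV_deriv_iff_real_differentiable)

text \<open>Derivatives are unique: induction on \<open>l\<close> along \<open>k = 0\<close>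
  identifies the pure v-derivatives, and induction on \<open>k\<close> then adds the
  x-derivatives.\<close>

lemma pure_partialsI:
  assumes f: "F 0 0 = f"
    and x: "\<And>k l x v. ((\<lambda>s. F k l (s, v)) has_real_derivative F (Suc k) l (x, v)) (at x)"
    and v: "\<And>l x v. ((\<lambda>s. F 0 l (x, s)) has_real_derivative F 0 (Suc l) (x, v)) (at v)"
  shows "pure_partials f" and "partial_xv k l f = F k l"
proof -
  have 0: "partial_xv 0 l f = F 0 l" for l
  proof (induction l)
    case (Suc l)
    then show ?case
      using DERIV_imp_deriv[OF v] by (auto simp: partial_xv_Suc_v partial_v_def)
  qed (simp add: f)
  have *: "partial_xv k l f = F k l" for k l
  proof (induction k)
    case (Suc k)
    then show ?case
      using DERIV_imp_deriv[OF x] by (auto simp: partial_xv_Suc_x partial_x_def)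
  qed (simp add: 0)
  then show "partial_xv k l f = F k l" .
  show "pure_partials f"
    unfolding pure_partials_def * using x v real_differentiable_def by blast
qed

text \<open>Smoothness passes to both partial derivatives, hence to all iterated ones; composing a
  Frechet differentiable function with a line parallel to an axis gives the one-variable
  differentiability.\<close>

lemma smooth_imp_pure_partials:
  assumes "smooth f"
  shows "pure_partials f"
proof -
  have px: "smooth (partial_x f)" and pv: "smooth (partial_v f)" and d: "f differentiable_on UNIV"
    if "smooth f" for f
  proof -
    have "times_cont_diff (Suc n) f" for n
      using that by (simp add: smooth_def)
    then show "smooth (partial_x f)" "smooth (partial_v f)" "f differentiable_on UNIV"
      by (simp_all add: smooth_def)
  qed
  have 0: "smooth ((partial_v ^^ l) f)" for l
    by (induction l) (use assms pv in auto)
  have sm: "smooth (partial_xv k l f)" for k l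
    unfolding partial_xv_def by (induction k) (use 0 px in auto)
  have dx: "(\<lambda>s. f (s, v)) differentiable (at x)" if "smooth f" for f :: "real \<times> real \<Rightarrow> real" and x v
  proof -
    have "f differentiable (at (x, v))"
      using d[OF that] by (simp add: differentiable_on_def)
    moreover have "(\<lambda>s. (s, v)) differentiable (at x)"
      by (intro differentiableI) (auto intro!: derivative_eq_intros)
    ultimately show ?thesis
      using differentiable_chain_at[of "\<lambda>s. (s, v)" x f] by (simp add: o_def)
  qed
  have dv: "(\<lambda>s. f (x, s)) differentiable (at v)" if "smooth f" for f :: "real \<times> real \<Rightarrow> real" and x v
  proof -
    have "f differentiable (at (x, v))"
      using d[OF that] by (simp add: differentiable_on_def)
    moreover have "(\<lambda>s. (x, s)) differentiable (at v)"
      by (intro differentiableI) (auto intro!: derivative_eq_intros)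
    ultimately show ?thesis
      using differentiable_chain_at[of "\<lambda>s. (x, s)" v f] by (simp add: o_def)
  qed
  show ?thesis
    unfolding pure_partials_def using dx[OF sm] dv[OF sm] by blast
qed

lemma
  assumes "pure_partials f" "pure_partials g"
  shows pure_partials_diff: "pure_partials (\<lambda>z. f z - g z)"
    and partial_xv_diff: "partial_xv k l (\<lambda>z. f z - g z) = (\<lambda>z. partial_xv k l f z - partial_xv k l g z)"
  by (rule pure_partialsI[where F = "\<lambda>k l z. partial_xv k l f z - partial_xv k l g z"];
      auto intro!: DERIV_diff pure_partials_DERIV_x pure_partials_DERIV_v assms)+

lemma partial_xv_add:
  assumes "pure_partials f" "pure_partials g"
  shows "partial_xv k l (\<lambda>z. f z + g z) = (\<lambda>z. partial_xv k l f z + partial_xv k l g z)"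
  by (rule pure_partialsI(2)[where F = "\<lambda>k l z. partial_xv k l f z + partial_xv k l g z"])
    (auto intro!: DERIV_add pure_partials_DERIV_x pure_partials_DERIV_v assms)

lemma
  assumes "pure_partials f"
  shows pure_partials_cmult: "pure_partials (\<lambda>z. a * f z)"
    and partial_xv_cmult: "partial_xv k l (\<lambda>z. a * f z) = (\<lambda>z. a * partial_xv k l f z)"
  by (rule pure_partialsI[where F = "\<lambda>k l z. a * partial_xv k l f z"];
      auto intro!: DERIV_cmult pure_partials_DERIV_x pure_partials_DERIV_v assms)+

lemma
  shows pure_partials_const: "pure_partials (\<lambda>z. a)"
    and partial_xv_const: "partial_xv k l (\<lambda>z. a) = (\<lambda>z. if k = 0 \<and> l = 0 then a else 0)"
  by (rule pure_partialsI[where F = "\<lambda>k l z. if k = 0 \<and> l = 0 then a else 0"]; auto)+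

text \<open>The induction step of the Leibniz rule, with \<open>A i j\<close> standing for \<open>f\<^sup>(\<^sup>i\<^sup>) g\<^sup>(\<^sup>j\<^sup>)\<close>.\<close>

lemma sum_binomial_Suc:
  fixes A :: "nat \<Rightarrow> nat \<Rightarrow> real"
  shows "(\<Sum>i\<le>k. of_nat (k choose i) * (A (Suc i) (k - i) + A i (Suc (k - i))))
    = (\<Sum>i\<le>Suc k. of_nat (Suc k choose i) * A i (Suc k - i))"
proof -
  \<comment> \<open>The added term at \<open>Suc k\<close> vanishes since
    \<open>k choose Suc k\<close> is 0. Splitting off the term at 0 and shifting aligns both halves
    for Pascal's rule.\<close>
  have "(\<Sum>i\<le>k. of_nat (k choose i) * A i (Suc (k - i)))
      = (\<Sum>i\<le>Suc k. of_nat (k choose i) * A i (Suc k - i))"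
    by (simp add: Suc_diff_le)
  also have "\<dots> = A 0 (Suc k) + (\<Sum>i\<le>k. of_nat (k choose Suc i) * A (Suc i) (k - i))"
    by (simp add: sum.atMost_Suc_shift del: sum.atMost_Suc)
  finally show ?thesis
    by (simp add: sum.atMost_Suc_shift distrib_left distrib_right sum.distrib del: sum.atMost_Suc)
qed

lemma
  assumes "pure_partials f" "pure_partials g"
  shows pure_partials_mult: "pure_partials (\<lambda>z. f z * g z)"
    and partial_xv_mult: "partial_xv k l (\<lambda>z. f z * g z) = (\<lambda>z. \<Sum>i\<le>k. of_nat (k choose i) *
      (\<Sum>j\<le>l. of_nat (l choose j) * (partial_xv i j f z * partial_xv (k - i) (l - j) g z)))"
proof -
  define H where "H = (\<lambda>k l z. \<Sum>i\<le>k. of_nat (k choose i) *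
      (\<Sum>j\<le>l. of_nat (l choose j) * (partial_xv i j f z * partial_xv (k - i) (l - j) g z)))"
  have 0: "H 0 0 = (\<lambda>z. f z * g z)"
    by (simp add: H_def)
  have x: "((\<lambda>s. H k l (s, v)) has_real_derivative H (Suc k) l (x, v)) (at x)" for k l x v
  proof -
    \<comment> \<open>For x-derivatives the whole inner sum over \<open>j\<close> plays the role of
      a single product, so the one-variable induction step applies with \<open>l\<close>
      fixed.\<close>
    define A where "A i m = (\<Sum>j\<le>l. of_nat (l choose j) *
      (partial_xv i j f (x, v) * partial_xv m (l - j) g (x, v)))" for i m
    have "((\<lambda>s. H k l (s, v)) has_real_derivative
      (\<Sum>i\<le>k. of_nat (k choose i) * (A (Suc i) (k - i) + A i (Suc (k - i))))) (at x)"
      unfolding H_def A_def sum.distrib[symmetric] distrib_left[symmetric]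
      by (intro DERIV_sum DERIV_cmult)
        (rule DERIV_cong[OF DERIV_mult[OF pure_partials_DERIV_x[OF assms(1)] pure_partials_DERIV_x[OF assms(2)]]], simp)
    also have "(\<Sum>i\<le>k. of_nat (k choose i) * (A (Suc i) (k - i) + A i (Suc (k - i)))) = H (Suc k) l (x, v)"
      unfolding sum_binomial_Suc by (simp only: A_def H_def)
    finally show ?thesis .
  qed
  have v: "((\<lambda>s. H 0 l (x, s)) has_real_derivative H 0 (Suc l) (x, v)) (at v)" for l x v
  proof -
    define A where "A j m = partial_xv 0 j f (x, v) * partial_xv 0 m g (x, v)" for j m
    have H0: "H 0 l z = (\<Sum>j\<le>l. of_nat (l choose j) * (partial_xv 0 j f z * partial_xv 0 (l - j) g z))" for l z
      by (simp add: H_def)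
    have "((\<lambda>s. H 0 l (x, s)) has_real_derivative
      (\<Sum>j\<le>l. of_nat (l choose j) * (A (Suc j) (l - j) + A j (Suc (l - j))))) (at v)"
      unfolding H0 A_def
      by (intro DERIV_sum DERIV_cmult)
        (rule DERIV_cong[OF DERIV_mult[OF pure_partials_DERIV_v[OF assms(1)] pure_partials_DERIV_v[OF assms(2)]]], simp)
    also have "(\<Sum>j\<le>l. of_nat (l choose j) * (A (Suc j) (l - j) + A j (Suc (l - j)))) = H 0 (Suc l) (x, v)"
      unfolding sum_binomial_Suc by (simp only: A_def H0)
    finally show ?thesis .
  qed
  show "pure_partials (\<lambda>z. f z * g z)" "partial_xv k l (\<lambda>z. f z * g z) = (\<lambda>z. \<Sum>i\<le>k. of_nat (k choose i) *
      (\<Sum>j\<le>l. of_nat (l choose j) * (partial_xv i j f z * partial_xv (k - i) (l - j) g z)))"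
    using pure_partialsI[of H, OF 0 x v] by (simp_all only: H_def)
qed

lemma pure_partials_power: "pure_partials f \<Longrightarrow> pure_partials (\<lambda>z. f z ^ n)"
  by (induction n) (auto intro: pure_partials_const pure_partials_mult)

section \<open>Supremum norms and estimates of single coefficients\<close>

lemma le_sup_norm: "ennreal \<bar>f z\<bar> \<le> sup_norm f"
  unfolding sup_norm_def by (rule SUP_upper) simp

lemma sup_norm_leI: "(\<And>z. ennreal \<bar>f z\<bar> \<le> b) \<Longrightarrow> sup_norm f \<le> b"
  unfolding sup_norm_def by (rule SUP_least)

lemma sup_norm_diff_le: "sup_norm (\<lambda>z. f z - g z) \<le> sup_norm f + sup_norm g"
proof (rule sup_norm_leI)
  fix z
  have "ennreal \<bar>f z - g z\<bar> \<le> ennreal \<bar>f z\<bar> + ennreal \<bar>g z\<bar>"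
    by (simp flip: ennreal_plus)
  also have "\<dots> \<le> sup_norm f + sup_norm g"
    by (intro add_mono le_sup_norm)
  finally show "ennreal \<bar>f z - g z\<bar> \<le> sup_norm f + sup_norm g" .
qed

lemma sup_norm_add_le: "sup_norm (\<lambda>z. f z + g z) \<le> sup_norm f + sup_norm g"
proof (rule sup_norm_leI)
  fix z
  have "ennreal \<bar>f z + g z\<bar> \<le> ennreal \<bar>f z\<bar> + ennreal \<bar>g z\<bar>"
    by (simp flip: ennreal_plus)
  also have "\<dots> \<le> sup_norm f + sup_norm g"
    by (intro add_mono le_sup_norm)
  finally show "ennreal \<bar>f z + g z\<bar> \<le> sup_norm f + sup_norm g" .
qed

lemma sup_norm_cmult: "sup_norm (\<lambda>z. a * f z) = ennreal \<bar>a\<bar> * sup_norm f"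
  unfolding sup_norm_def by (simp add: abs_mult ennreal_mult SUP_mult_left_ennreal)

lemma coef_diff_le:
  assumes "pure_partials f" "pure_partials g"
  shows "coef lam (\<lambda>z. f z - g z) p \<le> coef lam f p + coef lam g p"
  unfolding coef_def
  by (auto simp: partial_xv_diff assms split_def simp flip: distrib_left intro!: mult_left_mono sup_norm_diff_le)

lemma coef_add_le:
  assumes "pure_partials f" "pure_partials g"
  shows "coef lam (\<lambda>z. f z + g z) p \<le> coef lam f p + coef lam g p"
  unfolding coef_def
  by (auto simp: partial_xv_add assms split_def simp flip: distrib_left intro!: mult_left_mono sup_norm_add_le)

lemma coef_cmult:
  assumes "pure_partials f"
  shows "coef lam (\<lambda>z. a * f z) p = ennreal \<bar>a\<bar> * coef lam f p"
  unfolding coef_def by (simp add: partial_xv_cmult assms split_def sup_norm_cmult mult_ac)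

text \<open>Dividing by \<open>fact k * fact l\<close> absorbs the binomial coefficients of the
  Leibniz rule, leaving exactly the weights of the two factors.\<close>

lemma coef_mult_le:
  assumes "pure_partials f" "pure_partials g" "lam > 0"
  shows "coef lam (\<lambda>z. f z * g z) p \<le> cauchy_prod (coef lam f) (coef lam g) p"
proof -
  obtain k l where p: "p = (k, l)" by fastforce
  let ?t = "\<lambda>i j. real (k choose i) * real (l choose j)"
  have "sup_norm (partial_xv k l (\<lambda>z. f z * g z))
    \<le> (\<Sum>i\<le>k. \<Sum>j\<le>l. ennreal (?t i j) * (sup_norm (partial_xv i j f) * sup_norm (partial_xv (k - i) (l - j) g)))"
  proof (rule sup_norm_leI)
    fix z
    let ?P = "\<lambda>i j. partial_xv i j f z * partial_xv (k - i) (l - j) g z"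
    have "\<bar>partial_xv k l (\<lambda>z. f z * g z) z\<bar> = \<bar>\<Sum>i\<le>k. \<Sum>j\<le>l. ?t i j * ?P i j\<bar>"
      by (simp add: partial_xv_mult assms sum_distrib_left mult.assoc)
    also have "\<dots> \<le> (\<Sum>i\<le>k. \<Sum>j\<le>l. \<bar>?t i j * ?P i j\<bar>)"
      by (intro order_trans[OF sum_abs] sum_mono) simp
    finally have "ennreal \<bar>partial_xv k l (\<lambda>z. f z * g z) z\<bar> \<le> ennreal (\<Sum>i\<le>k. \<Sum>j\<le>l. \<bar>?t i j * ?P i j\<bar>)"
      by (rule ennreal_leI)
    also have "\<dots> = (\<Sum>i\<le>k. \<Sum>j\<le>l. ennreal (?t i j) *
        (ennreal \<bar>partial_xv i j f z\<bar> * ennreal \<bar>partial_xv (k - i) (l - j) g z\<bar>))"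
      by (simp add: sum_nonneg abs_mult ennreal_mult flip: sum_ennreal)
    also have "\<dots> \<le> (\<Sum>i\<le>k. \<Sum>j\<le>l. ennreal (?t i j) *
        (sup_norm (partial_xv i j f) * sup_norm (partial_xv (k - i) (l - j) g)))"
      by (intro sum_mono mult_mono le_sup_norm) auto
    finally show "ennreal \<bar>partial_xv k l (\<lambda>z. f z * g z) z\<bar> \<le> \<dots>" .
  qed
  then have "coef lam (\<lambda>z. f z * g z) p \<le> ennreal (lam ^ (k + l) / (fact k * fact l)) *
    (\<Sum>i\<le>k. \<Sum>j\<le>l. ennreal (?t i j) * (sup_norm (partial_xv i j f) * sup_norm (partial_xv (k - i) (l - j) g)))"
    unfolding coef_def p by (simp add: mult_left_mono)
  also have "\<dots> = cauchy_prod (coef lam f) (coef lam g) p"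
    unfolding cauchy_prod_def p prod.case sum_distrib_left
  proof (intro sum.cong refl)
    fix i j assume ij: "i \<in> {..k}" "j \<in> {..l}"
    let ?c = "\<lambda>k l. lam ^ (k + l) / (fact k * fact l)"
    have "?c k l * ?t i j = ?c i j * ?c (k - i) (l - j)"
    proof -
      have "lam ^ (k + l) = lam ^ (i + j) * lam ^ (k - i + (l - j))"
        using ij by (simp flip: power_add)
      then show ?thesis
        using ij by (simp add: binomial_fact field_simps)
    qed
    then have "ennreal (?c k l) * ennreal (?t i j) = ennreal (?c i j) * ennreal (?c (k - i) (l - j))"
      using assms(3) by (simp flip: ennreal_mult)
    then show "ennreal (?c k l) * (ennreal (?t i j) * (sup_norm (partial_xv i j f) * sup_norm (partial_xv (k - i) (l - j) g)))
      = coef lam f (i, j) * coef lam g (k - i, l - j)"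
      unfolding coef_def prod.case by (simp only: mult.assoc[symmetric]) (simp only: mult_ac)
  qed
  finally show ?thesis .
qed

lemma coef_const: "coef lam (\<lambda>z. a) p = (if p = (0, 0) then ennreal \<bar>a\<bar> else 0)"
  by (cases p) (auto simp: coef_def partial_xv_const sup_norm_def)

text \<open>The supremum norms are summable at every order, so by the Weierstrass M-test the series
  of derivatives converge uniformly and termwise differentiation is legitimate;
  \<open>pure_partialsI\<close> then identifies the derivatives of the sum.\<close>

lemma sup_norm_partial_xv_suminf_le:
  fixes g :: "nat \<Rightarrow> real \<times> real \<Rightarrow> real"
  assumes g: "\<And>n. pure_partials (g n)"
    and fin: "\<And>k l. (\<Sum>n. sup_norm (partial_xv k l (g n))) < \<infinity>"
  shows "sup_norm (partial_xv k l (\<lambda>z. \<Sum>n. g n z)) \<le> (\<Sum>n. sup_norm (partial_xv k l (g n)))"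
proof -
  \<comment> \<open>The M-test needs real bounds. Finiteness of the sums makes each supremum norm
    finite, so nothing is lost by \<open>enn2real\<close>.\<close>
  define M where "M k l n = enn2real (sup_norm (partial_xv k l (g n)))" for k l n
  have M_eq: "ennreal (M k l n) = sup_norm (partial_xv k l (g n))" for k l n
  proof -
    have "sup_norm (partial_xv k l (g n)) \<le> (\<Sum>n. sup_norm (partial_xv k l (g n)))"
      using sum_le_suminf[of "\<lambda>n. sup_norm (partial_xv k l (g n))" "{n}"] by simp
    then show ?thesis
      using fin[of k l] by (simp add: M_def ennreal_enn2real_if le_less_trans less_top)
  qed
  have M0: "0 \<le> M k l n" for k l n by (simp add: M_def)
  have le: "norm (partial_xv k l (g n) z) \<le> M k l n" for k l n z
    using le_sup_norm[of "partial_xv k l (g n)" z] M0 by (simp flip: M_eq)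
  have sM: "summable (M k l)" for k l
    using fin[of k l] M0 by (intro summable_suminf_not_top) (auto simp: M_eq)
  have sg: "summable (\<lambda>n. norm (partial_xv k l (g n) z))" for k l z
    by (rule summable_comparison_test'[OF sM[of k l], where N = 0]) (use le in simp)
  let ?F = "\<lambda>k l z. \<Sum>n. partial_xv k l (g n) z"
  have x: "((\<lambda>s. ?F k l (s, v)) has_real_derivative ?F (Suc k) l (x, v)) (at x)" for k l x v
    by (rule has_field_derivative_series'(2)[where S = UNIV and x0 = x])
      (simp_all add: pure_partials_DERIV_x[OF g] summable_norm_cancel[OF sg]
        Weierstrass_m_test'[where M = "M (Suc k) l", OF le sM])
  have v: "((\<lambda>s. ?F 0 l (x, s)) has_real_derivative ?F 0 (Suc l) (x, v)) (at v)" for l x v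
    by (rule has_field_derivative_series'(2)[where S = UNIV and x0 = v])
      (simp_all add: pure_partials_DERIV_v[OF g] summable_norm_cancel[OF sg]
        Weierstrass_m_test'[where M = "M 0 (Suc l)", OF le sM])
  have 0: "?F 0 0 = (\<lambda>z. \<Sum>n. g n z)" by simp
  have eq: "partial_xv k l (\<lambda>z. \<Sum>n. g n z) = ?F k l"
    by (rule pure_partialsI(2)[of ?F, OF 0 x v])
  show "sup_norm (partial_xv k l (\<lambda>z. \<Sum>n. g n z)) \<le> (\<Sum>n. sup_norm (partial_xv k l (g n)))"
    unfolding eq
  proof (rule sup_norm_leI)
    fix z
    have "\<bar>?F k l z\<bar> \<le> (\<Sum>n. norm (partial_xv k l (g n) z))"
      using summable_norm[OF sg[of k l z]] by simp
    also have "\<dots> \<le> (\<Sum>n. M k l n)"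
      by (rule suminf_le) (use le sg sM in auto)
    finally have "ennreal \<bar>?F k l z\<bar> \<le> ennreal (\<Sum>n. M k l n)"
      by (rule ennreal_leI)
    also have "\<dots> = (\<Sum>n. sup_norm (partial_xv k l (g n)))"
      by (simp add: suminf_ennreal2[OF M0 sM, symmetric] M_eq)
    finally show "ennreal \<bar>?F k l z\<bar> \<le> \<dots>" .
  qed
qed

section \<open>Triangle inequalities and product rules for the norms\<close>

lemma degree_sum_mono: "(\<And>p. a p \<le> b p) \<Longrightarrow> degree_sum a \<le> degree_sum b"
  unfolding degree_sum_def by (intro nn_integral_mono mult_left_mono) auto

lemma degree_sum_add: "degree_sum (\<lambda>p. a p + b p) = degree_sum a + degree_sum b"
  unfolding degree_sum_def by (simp add: distrib_left nn_integral_add)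

lemma wnorm_mult_le:
  assumes "pure_partials f" "pure_partials g" "lam > 0"
  shows "wnorm lam (\<lambda>z. f z * g z) \<le> wnorm lam f * wnorm lam g"
  unfolding wnorm_eq nn_integral_cauchy_prod[symmetric]
  by (intro nn_integral_mono coef_mult_le assms)

lemma wnorm_deriv_mult_le:
  assumes "pure_partials f" "pure_partials g" "lam > 0"
  shows "wnorm_deriv lam 1 (\<lambda>z. f z * g z)
    \<le> wnorm_deriv lam 1 f * wnorm lam g + wnorm lam f * wnorm_deriv lam 1 g"
proof -
  have "degree_sum (coef lam (\<lambda>z. f z * g z))
      \<le> degree_sum (coef lam f) * wnorm lam g + wnorm lam f * degree_sum (coef lam g)"
    unfolding wnorm_eq degree_sum_cauchy_prod[symmetric]
    by (intro degree_sum_mono coef_mult_le assms)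
  then have "ennreal (1 / lam) * degree_sum (coef lam (\<lambda>z. f z * g z))
      \<le> ennreal (1 / lam) * (degree_sum (coef lam f) * wnorm lam g + wnorm lam f * degree_sum (coef lam g))"
    by (rule mult_left_mono) simp
  then show ?thesis
    unfolding wnorm_deriv_1_eq[OF assms(3)] by (simp only: distrib_left mult_ac)
qed

lemma wnorm_add_le:
  assumes "pure_partials f" "pure_partials g"
  shows "wnorm lam (\<lambda>z. f z + g z) \<le> wnorm lam f + wnorm lam g"
  unfolding wnorm_eq
  by (subst nn_integral_add[symmetric]) (auto intro!: nn_integral_mono coef_add_le assms)

lemma wnorm_diff_le:
  assumes "pure_partials f" "pure_partials g"
  shows "wnorm lam (\<lambda>z. f z - g z) \<le> wnorm lam f + wnorm lam g"
  unfolding wnorm_eq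
  by (subst nn_integral_add[symmetric]) (auto intro!: nn_integral_mono coef_diff_le assms)

lemma wnorm_deriv_add_le:
  assumes "pure_partials f" "pure_partials g" "lam > 0"
  shows "wnorm_deriv lam 1 (\<lambda>z. f z + g z) \<le> wnorm_deriv lam 1 f + wnorm_deriv lam 1 g"
  unfolding wnorm_deriv_1_eq[OF assms(3)] distrib_left[symmetric] degree_sum_add[symmetric]
  by (intro mult_left_mono degree_sum_mono coef_add_le assms) simp

lemma wnorm_const: "wnorm lam (\<lambda>z. a) = ennreal \<bar>a\<bar>"
proof -
  have "wnorm lam (\<lambda>z. a) = (\<Sum>p\<in>{(0, 0)}. coef lam (\<lambda>z. a) p)"
    unfolding wnorm_eq by (rule nn_integral_count_space') (auto simp: coef_const split: if_splits)
  then show ?thesis by (simp add: coef_const)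
qed

lemma wnorm_deriv_const:
  assumes "lam > 0"
  shows "wnorm_deriv lam 1 (\<lambda>z. a) = 0"
proof -
  have "of_nat (fst p + snd p) * coef lam (\<lambda>z. a) p = 0" for p
    by (simp add: coef_const)
  then show ?thesis
    unfolding wnorm_deriv_1_eq[OF assms] degree_sum_def by (simp only:) simp
qed

section \<open>Powers and differences of powers\<close>

context
  fixes lam :: real and r :: ennreal and f :: "real \<times> real \<Rightarrow> real"
  assumes lam: "lam > 0" and f: "pure_partials f" "wnorm lam f \<le> r"
begin

text \<open>The bound uses an arbitrary \<open>r\<close> above the norm so that two functions can
  later share the same \<open>r\<close>.\<close>

lemma wnorm_power_le: "wnorm lam (\<lambda>z. f z ^ n) \<le> r ^ n"
proof (induction n)
  case 0
  then show ?case by (simp add: wnorm_const)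
next
  case (Suc n)
  have "wnorm lam (\<lambda>z. f z ^ Suc n) \<le> wnorm lam f * wnorm lam (\<lambda>z. f z ^ n)"
    unfolding power_Suc by (intro wnorm_mult_le f pure_partials_power lam)
  also have "\<dots> \<le> r * r ^ n"
    using Suc f by (intro mult_mono) auto
  finally show ?case by simp
qed

lemma wnorm_deriv_power_le:
  "wnorm_deriv lam 1 (\<lambda>z. f z ^ n) \<le> of_nat n * r ^ (n - 1) * wnorm_deriv lam 1 f"
proof (induction n)
  case 0
  then show ?case by (simp add: wnorm_deriv_const[OF lam, simplified])
next
  case (Suc n)
  have "wnorm_deriv lam 1 (\<lambda>z. f z ^ Suc n)
      \<le> wnorm_deriv lam 1 f * wnorm lam (\<lambda>z. f z ^ n) + wnorm lam f * wnorm_deriv lam 1 (\<lambda>z. f z ^ n)"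
    unfolding power_Suc by (intro wnorm_deriv_mult_le f pure_partials_power lam)
  also have "\<dots> \<le> wnorm_deriv lam 1 f * r ^ n + r * (of_nat n * r ^ (n - 1) * wnorm_deriv lam 1 f)"
    by (intro add_mono mult_mono wnorm_power_le f Suc) auto
  also have "\<dots> = of_nat (Suc n) * r ^ (Suc n - 1) * wnorm_deriv lam 1 f"
    by (cases n) (simp_all add: algebra_simps)
  finally show ?case .
qed

end

lemma power_Suc_diff_split:
  fixes u w :: "'a \<Rightarrow> 'b::comm_ring_1"
  shows "(\<lambda>z. u z ^ Suc n - w z ^ Suc n) = (\<lambda>z. u z ^ n * (u z - w z) + (u z ^ n - w z ^ n) * w z)"
  by (auto simp: algebra_simps)

context
  fixes lam :: real and r :: ennreal and u w :: "real \<times> real \<Rightarrow> real"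
  assumes lam: "lam > 0" and u: "pure_partials u" "wnorm lam u \<le> r" and w: "pure_partials w" "wnorm lam w \<le> r"
begin

lemma wnorm_power_diff_le:
  "wnorm lam (\<lambda>z. u z ^ n - w z ^ n) \<le> of_nat n * r ^ (n - 1) * wnorm lam (\<lambda>z. u z - w z)"
proof (induction n)
  case 0
  then show ?case by (simp add: wnorm_const)
next
  case (Suc n)
  let ?D = "wnorm lam (\<lambda>z. u z - w z)"
  have "wnorm lam (\<lambda>z. u z ^ Suc n - w z ^ Suc n)
      \<le> wnorm lam (\<lambda>z. u z ^ n * (u z - w z)) + wnorm lam (\<lambda>z. (u z ^ n - w z ^ n) * w z)"
    unfolding power_Suc_diff_split
    by (intro wnorm_add_le pure_partials_mult pure_partials_diff pure_partials_power u w)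
  also have "\<dots> \<le> wnorm lam (\<lambda>z. u z ^ n) * ?D + wnorm lam (\<lambda>z. u z ^ n - w z ^ n) * wnorm lam w"
    by (intro add_mono wnorm_mult_le pure_partials_diff pure_partials_power u w lam)
  also have "\<dots> \<le> r ^ n * ?D + (of_nat n * r ^ (n - 1) * ?D) * r"
    by (intro add_mono mult_mono wnorm_power_le Suc u w lam) auto
  also have "\<dots> = of_nat (Suc n) * r ^ (Suc n - 1) * ?D"
    by (cases n) (simp_all add: algebra_simps)
  finally show ?case .
qed

text \<open>The two coefficients are the first and second derivatives of z^n at \<open>r\<close>,
  which turn into the two majorants after summation.\<close>

lemma wnorm_deriv_power_diff_le:
  "wnorm_deriv lam 1 (\<lambda>z. u z ^ n - w z ^ n)
    \<le> of_nat n * r ^ (n - 1) * wnorm_deriv lam 1 (\<lambda>z. u z - w z)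
      + of_nat (n * (n - 1)) * r ^ (n - 2) * (wnorm_deriv lam 1 u + wnorm_deriv lam 1 w)
        * wnorm lam (\<lambda>z. u z - w z)"
proof (induction n)
  case 0
  then show ?case by (simp add: wnorm_deriv_const[OF lam, simplified])
next
  case (Suc n)
  let ?D = "wnorm lam (\<lambda>z. u z - w z)" and ?D1 = "wnorm_deriv lam 1 (\<lambda>z. u z - w z)"
  let ?U = "wnorm_deriv lam 1 u" and ?W = "wnorm_deriv lam 1 w"
  have "wnorm_deriv lam 1 (\<lambda>z. u z ^ Suc n - w z ^ Suc n)
      \<le> wnorm_deriv lam 1 (\<lambda>z. u z ^ n * (u z - w z)) + wnorm_deriv lam 1 (\<lambda>z. (u z ^ n - w z ^ n) * w z)"
    unfolding power_Suc_diff_split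
    by (intro wnorm_deriv_add_le pure_partials_mult pure_partials_diff pure_partials_power u w lam)
  also have "\<dots> \<le> (wnorm_deriv lam 1 (\<lambda>z. u z ^ n) * ?D + wnorm lam (\<lambda>z. u z ^ n) * ?D1)
      + (wnorm_deriv lam 1 (\<lambda>z. u z ^ n - w z ^ n) * wnorm lam w + wnorm lam (\<lambda>z. u z ^ n - w z ^ n) * ?W)"
    by (intro add_mono[OF wnorm_deriv_mult_le wnorm_deriv_mult_le]
        pure_partials_diff pure_partials_power u w lam)
  also have "\<dots> \<le> (of_nat n * r ^ (n - 1) * ?U * ?D + r ^ n * ?D1)
      + ((of_nat n * r ^ (n - 1) * ?D1 + of_nat (n * (n - 1)) * r ^ (n - 2) * (?U + ?W) * ?D) * r
        + of_nat n * r ^ (n - 1) * ?D * ?W)"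
    by (intro add_mono mult_mono wnorm_power_le wnorm_deriv_power_le wnorm_power_diff_le Suc u w lam) auto
  \<comment> \<open>The terms n \<open>?U\<close> \<open>?D\<close> and n \<open>?W\<close>
    \<open>?D\<close> join the n (n - 1) terms of the induction hypothesis to give the factor n^2.
    For n = 1 the truncated exponent \<open>n - 2\<close> is harmless because n (n - 1) = 0.\<close>
  also have "\<dots> = of_nat (Suc n) * r ^ n * ?D1 + of_nat (n * n) * r ^ (n - 1) * (?U + ?W) * ?D"
  proof (cases n)
    case (Suc m)
    then show ?thesis by (cases m) (simp_all add: algebra_simps, simp add: mult_2 distrib_left)
  qed simp
  also have "\<dots> \<le> of_nat (Suc n) * r ^ (Suc n - 1) * ?D1
      + of_nat (Suc n * (Suc n - 1)) * r ^ (Suc n - 2) * (?U + ?W) * ?D"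
  proof -
    \<comment> \<open>The only slack in the coefficients: n^2 is at most (n + 1) n, the coefficient
      in the second derivative of z^(n+1).\<close>
    have "(of_nat (n * n) :: ennreal) \<le> of_nat (Suc n * (Suc n - 1))"
      by (intro of_nat_mono) simp
    moreover have "Suc n - 2 = n - 1"
      by simp
    ultimately show ?thesis
      by (simp only: diff_Suc_1) (intro add_mono mult_right_mono order_refl zero_le)
  qed
  finally show ?case .
qed

end

section \<open>Finiteness of the majorant and control by the weighted norm\<close>

lemma majorant_deriv_finite:
  assumes "real_analytic_expansion \<Phi> R c" "r < ennreal R"
  shows "majorant_deriv c r < \<infinity>"
proof -
  obtain s where s: "r = ennreal s" "0 \<le> s"
    using assms(2) by (cases r) auto
  then have "s < R"
    using assms(2) by (simp add: ennreal_less_iff)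
  have sm: "summable (\<lambda>n. \<bar>c n\<bar> * x ^ n)" if "norm x < R" for x
  proof -
    have "summable (\<lambda>n. norm (c n * \<bar>x\<bar> ^ n))"
    proof (rule powser_insidea)
      \<comment> \<open>The midpoint of |x| and \<open>R\<close> is still inside the interval of
        convergence yet strictly beyond |x|, which yields absolute convergence at |x|.\<close>
      show "summable (\<lambda>n. c n * ((\<bar>x\<bar> + R) / 2) ^ n)"
        using assms(1) that unfolding real_analytic_expansion_def by (auto simp: sums_iff)
      show "norm \<bar>x\<bar> < norm ((\<bar>x\<bar> + R) / 2)"
        using that by auto
    qed
    then have "summable (\<lambda>n. norm (\<bar>c n\<bar> * x ^ n))"
      by (simp add: norm_mult norm_power power_abs abs_mult)
    then show ?thesis by (rule summable_norm_cancel)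
  qed
  have "summable (\<lambda>n. diffs (\<lambda>n. \<bar>c n\<bar>) n * s ^ n)"
    using \<open>s < R\<close> s by (intro termdiff_converges[of s R] sm) auto
  then have "summable (\<lambda>n. real (Suc n) * \<bar>c (Suc n)\<bar> * s ^ n)"
    by (simp add: diffs_def)
  then have "summable (\<lambda>n. real n * \<bar>c n\<bar> * s ^ (n - 1))"
    by (subst summable_Suc_iff[symmetric]) simp
  then have "(\<Sum>n. ennreal (real n * \<bar>c n\<bar> * s ^ (n - 1))) = ennreal (\<Sum>n. real n * \<bar>c n\<bar> * s ^ (n - 1))"
    using s by (intro suminf_ennreal2) auto
  then show ?thesis
    using s by (simp add: majorant_deriv_eq ennreal_mult ennreal_power)
qed

text \<open>The coefficient at (0, 0) is the supremum norm of \<open>f\<close>. Thus a norm below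
  \<open>R\<close> keeps the values of \<open>f\<close> where the power series converges.\<close>

lemma le_wnorm: "ennreal \<bar>f z\<bar> \<le> wnorm lam f"
proof -
  have "ennreal \<bar>f z\<bar> \<le> coef lam f (0, 0)"
    using le_sup_norm[of f z] by (simp add: coef_def)
  also have "\<dots> \<le> wnorm lam f"
    unfolding wnorm_eq by (rule nn_integral_ge_point) simp
  finally show ?thesis .
qed

text \<open>One coefficient is at most the whole sum. The factor depends only on the order, so
  summable norms give summable derivatives of each fixed order.\<close>

lemma sup_norm_partial_xv_le_wnorm:
  assumes "lam > 0"
  shows "sup_norm (partial_xv k l f) \<le> ennreal (fact k * fact l / lam ^ (k + l)) * wnorm lam f"
proof -
  have "coef lam f (k, l) \<le> wnorm lam f"
    unfolding wnorm_eq by (rule nn_integral_ge_point) simp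
  then have "ennreal (fact k * fact l / lam ^ (k + l)) * coef lam f (k, l)
    \<le> ennreal (fact k * fact l / lam ^ (k + l)) * wnorm lam f"
    by (rule mult_left_mono) simp
  moreover have "ennreal (fact k * fact l / lam ^ (k + l)) * coef lam f (k, l) = sup_norm (partial_xv k l f)"
    using assms by (simp add: coef_def flip: mult.assoc ennreal_mult)
  ultimately show ?thesis by simp
qed

section \<open>Summation of the monomial estimates over the power series\<close>

theorem lemma3p8:
  fixes R lam \<Lambda> :: real
    and \<Phi> :: "real \<Rightarrow> real" and c :: "nat \<Rightarrow> real"
    and u w :: "real \<times> real \<Rightarrow> real"
    and R0 :: ennreal
  assumes "R > 0"
    and "real_analytic_expansion \<Phi> R c"
    and "analytic_with_radius \<Lambda> u"
    and "analytic_with_radius \<Lambda> w"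
    and "0 < lam" and "lam < \<Lambda>"
    and "R0 = max (wnorm lam u) (wnorm lam w)"
    and "R0 < ennreal R"
  shows "wnorm_deriv lam 1 (\<lambda>z. \<Phi> (u z) - \<Phi> (w z))
    \<le> majorant_deriv c R0 * wnorm_deriv lam 1 (\<lambda>z. u z - w z)
      + majorant_deriv2 c R0 * (wnorm_deriv lam 1 u + wnorm_deriv lam 1 w)
        * wnorm lam (\<lambda>z. u z - w z)"
proof -
  have lam: "lam > 0" by fact
  have u: "pure_partials u" "wnorm lam u \<le> R0" and w: "pure_partials w" "wnorm lam w \<le> R0"
    using assms by (auto simp: analytic_with_radius_def intro: smooth_imp_pure_partials)
  let ?D = "wnorm lam (\<lambda>z. u z - w z)" and ?D1 = "wnorm_deriv lam 1 (\<lambda>z. u z - w z)"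
  let ?S = "wnorm_deriv lam 1 u + wnorm_deriv lam 1 w"
  define h where "h n z = u z ^ n - w z ^ n" for n z
  define g where "g n z = c n * h n z" for n z
  have h: "pure_partials (h n)" for n
    unfolding h_def by (intro pure_partials_diff pure_partials_power u w)
  have g: "pure_partials (g n)" for n
    unfolding g_def by (intro pure_partials_cmult h)
  have coef_g: "coef lam (g n) p = ennreal \<bar>c n\<bar> * coef lam (h n) p" for n p
    unfolding g_def by (rule coef_cmult[OF h])

  have expansion: "(\<lambda>n. c n * f z ^ n) sums \<Phi> (f z)"
    if "wnorm lam f \<le> R0" for f :: "real \<times> real \<Rightarrow> real" and z
  proof -
    have "ennreal \<bar>f z\<bar> < ennreal R"
      using le_wnorm that \<open>R0 < ennreal R\<close> by (meson le_less_trans order_trans)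
    then have "\<bar>f z\<bar> < R"
      by (simp add: ennreal_less_iff)
    then show ?thesis
      using assms(2) by (simp add: real_analytic_expansion_def)
  qed
  have "(\<lambda>n. g n z) sums (\<Phi> (u z) - \<Phi> (w z))" for z
    using sums_diff[OF expansion[OF u(2)] expansion[OF w(2)]] by (simp add: g_def h_def right_diff_distrib)
  then have eq: "(\<lambda>z. \<Phi> (u z) - \<Phi> (w z)) = (\<lambda>z. \<Sum>n. g n z)"
    by (auto simp: sums_iff)

  \<comment> \<open>Finiteness of \<open>?D\<close>, together with that of
    \<open>majorant_deriv c R0\<close>, makes the norms of the \<open>g n\<close> summable, as
    termwise differentiation requires.\<close>
  have "?D \<le> R0 + R0"
    using wnorm_diff_le[OF u(1) w(1)] add_mono[OF u(2) w(2)] by (rule order_trans)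
  then have "?D < \<infinity>"
    using \<open>R0 < ennreal R\<close> by (metis ennreal_add_eq_top ennreal_less_top infinity_ennreal_def less_top order_less_trans top.extremum_uniqueI)
  have wnorm_g: "wnorm lam (g n) = ennreal \<bar>c n\<bar> * wnorm lam (h n)" for n
    by (simp add: wnorm_eq coef_g nn_integral_cmult)
  have "(\<Sum>n. wnorm lam (g n)) \<le> (\<Sum>n. ennreal (real n * \<bar>c n\<bar>) * R0 ^ (n - 1) * ?D)"
  proof (intro suminf_le summableI)
    fix n
    have "wnorm lam (g n) \<le> ennreal \<bar>c n\<bar> * (of_nat n * R0 ^ (n - 1) * ?D)"
      unfolding wnorm_g h_def by (intro mult_left_mono wnorm_power_diff_le lam u w) simp
    then show "wnorm lam (g n) \<le> ennreal (real n * \<bar>c n\<bar>) * R0 ^ (n - 1) * ?D"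
      by (simp add: ennreal_mult ennreal_of_nat_eq_real_of_nat mult_ac)
  qed
  also have "\<dots> = majorant_deriv c R0 * ?D"
    by (simp add: majorant_deriv_eq ennreal_suminf_multc)
  also have "\<dots> < \<infinity>"
    using majorant_deriv_finite[OF assms(2,8)] \<open>?D < \<infinity>\<close> by (simp add: ennreal_mult_less_top)
  finally have sum_wnorm: "(\<Sum>n. wnorm lam (g n)) < \<infinity>" .
  have fin: "(\<Sum>n. sup_norm (partial_xv k l (g n))) < \<infinity>" for k l
  proof -
    have "(\<Sum>n. sup_norm (partial_xv k l (g n)))
        \<le> (\<Sum>n. ennreal (fact k * fact l / lam ^ (k + l)) * wnorm lam (g n))"
      by (intro suminf_le summableI sup_norm_partial_xv_le_wnorm lam)
    also have "\<dots> < \<infinity>"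
      using sum_wnorm by (simp add: ennreal_suminf_cmult ennreal_mult_less_top)
    finally show ?thesis .
  qed

  have "coef lam (\<lambda>z. \<Sum>n. g n z) p \<le> (\<Sum>n. coef lam (g n) p)" for p
    unfolding coef_def using sup_norm_partial_xv_suminf_le[OF g fin]
    by (auto simp: split_def ennreal_suminf_cmult intro!: mult_left_mono)
  then have "degree_sum (coef lam (\<lambda>z. \<Sum>n. g n z)) \<le> degree_sum (\<lambda>p. \<Sum>n. coef lam (g n) p)"
    by (rule degree_sum_mono)
  \<comment> \<open>Monotone convergence exchanges the series over n with the sum over derivative
    orders.\<close>
  also have "\<dots> = (\<Sum>n. ennreal \<bar>c n\<bar> * degree_sum (coef lam (h n)))"
    by (simp add: degree_sum_def coef_g nn_integral_suminf nn_integral_cmult mult.left_commute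
        flip: ennreal_suminf_cmult)
  finally have "wnorm_deriv lam 1 (\<lambda>z. \<Sum>n. g n z)
      \<le> ennreal (1 / lam) * (\<Sum>n. ennreal \<bar>c n\<bar> * degree_sum (coef lam (h n)))"
    unfolding wnorm_deriv_1_eq[OF lam] by (rule mult_left_mono) simp
  also have "\<dots> = (\<Sum>n. ennreal \<bar>c n\<bar> * wnorm_deriv lam 1 (h n))"
    by (simp only: wnorm_deriv_1_eq[OF lam] mult.left_commute flip: ennreal_suminf_cmult)
  also have "\<dots> \<le> (\<Sum>n. ennreal (real n * \<bar>c n\<bar>) * R0 ^ (n - 1) * ?D1
      + ennreal (real (n * (n - 1)) * \<bar>c n\<bar>) * R0 ^ (n - 2) * (?S * ?D))"
  proof (intro suminf_le summableI)
    fix n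
    have "ennreal \<bar>c n\<bar> * wnorm_deriv lam 1 (h n) \<le> ennreal \<bar>c n\<bar> *
      (of_nat n * R0 ^ (n - 1) * ?D1 + of_nat (n * (n - 1)) * R0 ^ (n - 2) * ?S * ?D)"
      unfolding h_def by (intro mult_left_mono wnorm_deriv_power_diff_le lam u w) simp
    also have "\<dots> = ennreal (real n * \<bar>c n\<bar>) * R0 ^ (n - 1) * ?D1
      + ennreal (real (n * (n - 1)) * \<bar>c n\<bar>) * R0 ^ (n - 2) * (?S * ?D)"
      by (simp only: ennreal_mult ennreal_of_nat_eq_real_of_nat of_nat_0_le_iff abs_ge_zero
          distrib_left mult_ac)
    finally show "ennreal \<bar>c n\<bar> * wnorm_deriv lam 1 (h n) \<le> \<dots>" .
  qed
  also have "\<dots> = majorant_deriv c R0 * ?D1 + majorant_deriv2 c R0 * ?S * ?D"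
    by (simp only: majorant_deriv_eq majorant_deriv2_eq ennreal_suminf_multc mult.assoc[of _ ?S ?D]
        suminf_add[OF summableI summableI, symmetric])
  finally show ?thesis
    unfolding eq .
qed

end
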